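(* Let $(\mathcal A,\psi)$ be an algebra over a field $\Bbbk$ of characteristic zero, let $d$ be a derivation of $(\mathcal A,\psi)$, and put $D=d^2$. Then $D$ is a quasi-derivation of $(\mathcal A,\psi)$ if and only if $\psi$ vanishes identically on the image of $D$, i.e. $\psi(u,v)=0$ for all $u,v\in \operatorname{Im} D$.
   Context: An algebra $(\mathcal A,\psi)$ is a $\Bbbk$-vector space $\mathcal A$ (not necessarily finite-dimensional) with an arbitrary bilinear operation $\psi:\mathcal A\times\mathcal A\to\mathcal A$. For a linear map $D:\mathcal A\to\mathcal A$, the derived operation of $\psi$ with respect to $D$ is $$\psi'_D(x,y)=D(\psi(x,y))-\psi(Dx,y)-\psi(x,Dy),$$ and the second derived operation is $\psi''_D=(\psi'_D)'_D$. A derivation is a linear map $d$ with $\psi'_d=0$; a quasi-derivation is a linear map $D$ with $\psi''_D=0$. *)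

theory Defs
  imports Complex_Main
begin

locale nonassoc_algebra = vector_space scale
  for scale :: "'k::field \<Rightarrow> 'a::ab_group_add \<Rightarrow> 'a" +
  fixes \<psi> :: "'a \<Rightarrow> 'a \<Rightarrow> 'a"
  assumes linear_left: "\<And>y. Vector_Spaces.linear scale scale (\<lambda>x. \<psi> x y)"
    and linear_right: "\<And>x. Vector_Spaces.linear scale scale (\<lambda>y. \<psi> x y)"

definition derived_op :: "('a::ab_group_add \<Rightarrow> 'a) \<Rightarrow> ('a \<Rightarrow> 'a \<Rightarrow> 'a) \<Rightarrow> 'a \<Rightarrow> 'a \<Rightarrow> 'a" where
  "derived_op D \<psi> x y = D (\<psi> x y) - \<psi> (D x) y - \<psi> x (D y)"

definition second_derived_op ::
    "('a::ab_group_add \<Rightarrow> 'a) \<Rightarrow> ('a \<Rightarrow> 'a \<Rightarrow> 'a) \<Rightarrow> 'a \<Rightarrow> 'a \<Rightarrow> 'a" where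
  "second_derived_op D \<psi> = derived_op D (derived_op D \<psi>)"

definition is_derivation ::
    "('k::field \<Rightarrow> 'a::ab_group_add \<Rightarrow> 'a) \<Rightarrow> ('a \<Rightarrow> 'a \<Rightarrow> 'a) \<Rightarrow> ('a \<Rightarrow> 'a) \<Rightarrow> bool" where
  "is_derivation scale \<psi> d \<longleftrightarrow>
     Vector_Spaces.linear scale scale d \<and> (\<forall>x y. derived_op d \<psi> x y = 0)"

definition is_quasi_derivation ::
    "('k::field \<Rightarrow> 'a::ab_group_add \<Rightarrow> 'a) \<Rightarrow> ('a \<Rightarrow> 'a \<Rightarrow> 'a) \<Rightarrow> ('a \<Rightarrow> 'a) \<Rightarrow> bool" where
  "is_quasi_derivation scale \<psi> D \<longleftrightarrow>
     Vector_Spaces.linear scale scale D \<and> (\<forall>x y. second_derived_op D \<psi> x y = 0)"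

end

theory Submission
  imports Defs
begin

text \<open>
  The reason is the Leibniz rule of order two. For a derivation \<open>d\<close> it reads
  \<open>d\<^sup>2 (\<psi> x y) = \<psi> (d\<^sup>2 x) y + 2 \<psi> (d x) (d y) + \<psi> x (d\<^sup>2 y)\<close>, so the derived operation of
  \<open>\<psi>\<close> with respect to \<open>D = d\<^sup>2\<close> is the cross term \<open>2 \<psi> (d x) (d y)\<close>
  (\<open>derived_op_square\<close>). The map \<open>d\<close> is a derivation of this new operation as well
  (\<open>derived_op_cross_term\<close>), so the rule applies a second time and yields
  \<open>\<psi>''\<^sub>D x y = 4 \<psi> (D x) (D y)\<close>. In characteristic zero the factor \<open>4\<close> can be cancelled.
\<close>

text \<open>
  This is the Leibniz rule for \<open>d\<^sup>2\<close>: the mixed term arises twice, once for each order of the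
  two applications of \<open>d\<close>. It is stated for an arbitrary operation \<open>\<phi>\<close> so that it applies to
  \<open>\<psi>\<close> and to its derived operation alike.
\<close>

lemma derived_op_square:
  fixes d :: "'a::ab_group_add \<Rightarrow> 'a"
  assumes "additive d"
    and "\<And>x y. derived_op d \<phi> x y = 0"
  shows "derived_op (d \<circ> d) \<phi> x y = \<phi> (d x) (d y) + \<phi> (d x) (d y)"
proof -
  have leibniz: "d (\<phi> x y) = \<phi> (d x) y + \<phi> x (d y)" for x y
    using assms(2)[of x y] by (simp add: derived_op_def algebra_simps)
  show ?thesis
    by (simp add: derived_op_def leibniz additive.add[OF assms(1)])
qed

text \<open>
  Evaluating \<open>\<phi>\<close> at \<open>(d x, d y)\<close> commutes with applying \<open>d\<close> to an argument, so the Leibniz rule is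
  inherited; sums inherit it because \<open>d\<close> is additive.
\<close>

lemma derived_op_cross_term:
  fixes d :: "'a::ab_group_add \<Rightarrow> 'a"
  assumes "additive d"
    and "\<And>x y. derived_op d \<phi> x y = 0"
  shows "derived_op d (\<lambda>x y. \<phi> (d x) (d y) + \<phi> (d x) (d y)) x y = 0"
  using assms(2)[of "d x" "d y"]
  by (simp add: derived_op_def additive.add[OF assms(1)] algebra_simps)

lemma second_derived_op_square:
  fixes d :: "'a::ab_group_add \<Rightarrow> 'a"
  assumes "additive d"
    and "\<And>x y. derived_op d \<psi> x y = 0"
    and "D = d \<circ> d"
  shows "second_derived_op D \<psi> x y =
    (\<psi> (D x) (D y) + \<psi> (D x) (D y)) + (\<psi> (D x) (D y) + \<psi> (D x) (D y))"
proof -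
  have "derived_op D \<psi> = (\<lambda>x y. \<psi> (d x) (d y) + \<psi> (d x) (d y))"
    using derived_op_square[OF assms(1,2)] assms(3) by (intro ext) simp
  then show ?thesis
    using derived_op_square[OF assms(1) derived_op_cross_term[OF assms(1,2)]] assms(3)
    by (simp add: second_derived_op_def)
qed

lemma double_eq_0_iff:
  fixes scale :: "'k::field_char_0 \<Rightarrow> 'a::ab_group_add \<Rightarrow> 'a" and z :: 'a
  assumes "vector_space scale"
  shows "z + z = 0 \<longleftrightarrow> z = 0"
proof -
  interpret vector_space scale by (fact assms)
  have "z + z = scale 2 z"
    using scale_left_distrib[of 1 1 z] by simp
  then show ?thesis by simp
qed

theorem corollary3p2:
  fixes scale :: "'k::field_char_0 \<Rightarrow> 'a::ab_group_add \<Rightarrow> 'a"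
    and \<psi> :: "'a \<Rightarrow> 'a \<Rightarrow> 'a"
    and d D :: "'a \<Rightarrow> 'a"
  assumes "nonassoc_algebra scale \<psi>"
    and "is_derivation scale \<psi> d"
    and "D = d \<circ> d"
  shows "is_quasi_derivation scale \<psi> D \<longleftrightarrow> (\<forall>u\<in>range D. \<forall>v\<in>range D. \<psi> u v = 0)"
proof -
  have vs: "vector_space scale"
    using assms(1) by (simp add: nonassoc_algebra_def)
  have lin: "Vector_Spaces.linear scale scale d"
    and der: "\<And>x y. derived_op d \<psi> x y = 0"
    using assms(2) by (simp_all add: is_derivation_def)
  have "additive d"
    using lin by (simp add: additive_def Vector_Spaces.linear_def module_hom_def module_hom_axioms_def)
  then have "second_derived_op D \<psi> x y = 0 \<longleftrightarrow> \<psi> (D x) (D y) = 0" for x y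
    using second_derived_op_square[OF _ der assms(3)] by (simp add: double_eq_0_iff[OF vs])
  moreover have "Vector_Spaces.linear scale scale D"
    unfolding assms(3) using lin lin by (rule Vector_Spaces.linear_compose)
  ultimately show ?thesis
    by (simp add: is_quasi_derivation_def)
qed

end
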